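(* Let $\lambda_1 \approx 2.48$ be the greatest (real) root of the polynomial $x^3 - 2x^2 - 2x + 2$, and let $\varphi = \frac{1+\sqrt5}{2}$. Then, for positive integers $H$, $$V(H) \asymp H^{(\log \lambda_1)/\log \varphi},$$ that is, there exist constants $0 < c \le C$ such that $c\, H^{(\log \lambda_1)/\log\varphi} \le V(H) \le C\, H^{(\log \lambda_1)/\log\varphi}$ for every integer $H \ge 1$.
   Context: The Fibonacci numbers are $F_1 = F_2 = 1$ and $F_{m} = F_{m-1} + F_{m-2}$ for $m \ge 3$. The Fibonacci partition function $R(n)$ is the number of ways to write $n = x_1 + \cdots + x_s$, where $s \ge 0$ is arbitrary and $x_1 < \cdots < x_s$ are (positive) Fibonacci numbers. That is, $R(n)$ is the number of finite subsets of $\{F_2, F_3, F_4, \ldots\} = \{1,2,3,5,8,\ldots\}$ with sum $n$ (so the value $1$ can be used at most once). In particular $R(0) = 1$ (empty sum). For an integer $H \ge 0$ define $$V(H) = \sum_{n=0}^{H} R(n)^2.$$ *)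

theory Defs
  imports Complex_Main "HOL-Number_Theory.Fib" "HOL-Computational_Algebra.Polynomial"
begin

text \<open>
  The library function \<^const>\<open>fib\<close> has \<open>fib 0 = 0\<close> and \<open>fib 1 = fib 2 = 1\<close>, so starting the index
  at 2 lists every positive Fibonacci number exactly once.
\<close>

definition fib_partitions :: "nat \<Rightarrow> nat set set" where
  "fib_partitions n = {S. finite S \<and> S \<subseteq> {fib k | k. k \<ge> 2} \<and> \<Sum>S = n}"

definition R :: "nat \<Rightarrow> nat" where
  "R n = card (fib_partitions n)"

definition V :: "nat \<Rightarrow> nat" where
  "V H = (\<Sum>n = 0..H. R n ^ 2)"

definition phi :: real where
  "phi = (1 + sqrt 5) / 2"

definition lambda_poly :: "real poly" where
  "lambda_poly = [:2, - 2, - 2, 1:]" \<comment> \<open>constant coefficient first\<close>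

definition lambda1 :: real where
  "lambda1 = Max {x. poly lambda_poly x = 0}"

text \<open>
  The set counted by \<^const>\<open>R\<close> is finite, and the set in the definition of \<^const>\<open>lambda1\<close> is
  finite and nonempty, so neither \<^const>\<open>card\<close> nor \<^const>\<open>Max\<close> takes a default value.
\<close>

lemma finite_fib_partitions: "finite (fib_partitions n)"
proof (rule finite_subset)
  show "fib_partitions n \<subseteq> Pow {..n}"
  proof
    fix S assume "S \<in> fib_partitions n"
    then have S: "finite S" "\<Sum>S = n" by (simp_all add: fib_partitions_def)
    then have "x \<le> n" if "x \<in> S" for x
      using member_le_sum[of x S "\<lambda>x. x"] that by simp
    then show "S \<in> Pow {..n}" by blast
  qed
qed simp

lemma R_0: "R 0 = 1"
proof -
  have "S = {}" if "S \<in> fib_partitions 0" for S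
  proof (rule equals0I)
    fix x assume "x \<in> S"
    from that have S: "finite S" "S \<subseteq> {fib k | k. k \<ge> 2}" "\<Sum>S = 0"
      by (simp_all add: fib_partitions_def)
    from S(1,3) \<open>x \<in> S\<close> have "x = 0" by simp
    moreover from S(2) \<open>x \<in> S\<close> have "x \<in> {fib k | k. k \<ge> 2}" by (rule subsetD)
    then obtain k where "x = fib k" "k \<ge> 2" by blast
    ultimately show False using fib_neq_0_nat[of k] by simp
  qed
  moreover have "{} \<in> fib_partitions 0"
    by (simp add: fib_partitions_def)
  ultimately have "fib_partitions 0 = {{}}" by (intro equalityI subsetI) simp_all
  then show ?thesis by (simp add: R_def)
qed

lemma poly_lambda_poly: "poly lambda_poly x = x ^ 3 - 2 * x ^ 2 - 2 * x + 2"
  by (simp add: lambda_poly_def algebra_simps power2_eq_square power3_eq_cube)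

lemma finite_lambda_roots: "finite {x. poly lambda_poly x = 0}"
  by (rule poly_roots_finite) (simp add: lambda_poly_def)

lemma ex_lambda_root: "\<exists>x. 2.48 < x \<and> x < 2.49 \<and> poly lambda_poly x = 0"
  by (rule poly_IVT_pos) (simp_all add: poly_lambda_poly power2_eq_square power3_eq_cube)

lemma lambda1_root: "poly lambda_poly lambda1 = 0"
  using Max_in[OF finite_lambda_roots] ex_lambda_root by (auto simp: lambda1_def)

lemma lambda1_greatest: "poly lambda_poly x = 0 \<Longrightarrow> x \<le> lambda1"
  unfolding lambda1_def by (rule Max_ge[OF finite_lambda_roots]) simp

lemma lambda1_bounds: "2.48 < lambda1" "lambda1 < 2.49"
proof -
  show "2.48 < lambda1"
    using ex_lambda_root lambda1_greatest by fastforce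
  have "poly lambda_poly x > 0" if "x \<ge> 2.49" for x :: real
  proof -
    define y where "y = x - 2.49"
    have x: "x = y + 2.49" and "y \<ge> 0" using that by (simp_all add: y_def)
    have "poly lambda_poly x
        = y ^ 3 + 5.47 * y ^ 2 + 6.6403 * y + 0.058049"
      unfolding poly_lambda_poly x by (simp add: field_simps power2_eq_square power3_eq_cube)
    also have "\<dots> > 0" using \<open>y \<ge> 0\<close> by (intro add_nonneg_pos add_nonneg_nonneg) auto
    finally show ?thesis .
  qed
  then show "lambda1 < 2.49" using lambda1_root by (metis less_irrefl not_le)
qed

end

theory Submission
  imports Defs
begin

text \<open>
  Let \<open>A m\<close> be the number of pairs \<open>(S, T)\<close> of subsets of the first \<open>m\<close> Fibonacci numbers
  \<open>fib 2, \<dots>, fib (m + 1)\<close> with equal sums.  It is the sum over \<open>n\<close> of the squares of the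
  number of representations of \<open>n\<close> by these \<open>m\<close> numbers.  Representations of \<open>n < fib (m + 2)\<close> use
  no larger Fibonacci number, and the \<open>m\<close> numbers have total sum \<open>fib (m + 3) - 2\<close>; hence
  \<open>V H \<le> A m\<close> if \<open>H < fib (m + 2)\<close>, and \<open>A m \<le> V H\<close> if \<open>H + 2 \<ge> fib (m + 3)\<close>
  (\<open>V_le_fib_pairs\<close> and \<open>fib_pairs_le_V\<close>).  Everything reduces to the growth of \<open>A m\<close>.

  To get a recurrence, count more generally the pairs \<open>(S, T)\<close> with
  \<open>\<Sum>S - \<Sum>T = d\<close>, and call this number \<open>D m d\<close>.  Deciding membership of
  \<open>F = fib (m + 2)\<close> in \<open>S\<close> and \<open>T\<close> gives
  \<open>D (m + 1) d = 2 D m d + D m (d - F) + D m (d + F)\<close>.  The differences that occur when one starts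
  from \<open>d = 0\<close> are always \<open>0\<close>, \<open>fib (m + 2)\<close> or \<open>fib (m + 1)\<close>, up to sign and up to differences
  larger than the total sum, which contribute nothing.  With \<open>B m = D m (fib (m + 2))\<close> and
  \<open>C m = D m (fib (m + 1))\<close> this is the closed linear system
  \<open>A' = 2 A + 2 B\<close>, \<open>B' = C\<close>, \<open>C' = A + 2 B\<close>, whose characteristic polynomial is
  \<open>x ^ 3 - 2 x ^ 2 - 2 x + 2\<close>.  A left eigenvector for its root \<open>\<lambda>\<close> gives the exact identity
  \<open>A m + \<lambda> (\<lambda> - 2) B m + (\<lambda> - 2) C m = \<lambda> ^ m\<close>.  For \<open>\<lambda> = lambda1 > 2\<close> all
  coefficients are positive, and \<open>B m, C m \<le> A m\<close>, so \<open>A m\<close> lies between constant multiples of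
  \<open>\<lambda> ^ m\<close> (\<open>fib_pairs_bounds\<close>).

  Finally \<open>fib m\<close> has the order of \<open>phi ^ m\<close>, and \<open>phi\<close> raised to the exponent of the theorem is
  \<open>lambda1\<close>, so \<open>\<lambda> ^ m\<close> has the order of that power of \<open>H\<close> when \<open>H\<close> lies between consecutive
  Fibonacci numbers with indices near \<open>m\<close>.
\<close>

section \<open>Pairs of sets of Fibonacci numbers with a given difference of sums\<close>

text \<open>
  Sets are represented by their index sets, and the difference is an integer so that the recurrence
  below has no side conditions.  The count is written as a double sum of indicators because
  the recurrence then follows from splitting each sum separately.
\<close>

definition fib_pairs :: "nat \<Rightarrow> int \<Rightarrow> nat" where
  "fib_pairs m d = (\<Sum>S\<in>Pow {2..<m+2}. \<Sum>T\<in>Pow {2..<m+2}.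
     of_bool (int (sum fib S) = int (sum fib T) + d))"

lemma sum_Pow_insert:
  assumes "finite A" "x \<notin> A"
  shows "(\<Sum>S\<in>Pow (insert x A). f S) = (\<Sum>S\<in>Pow A. f S + f (insert x S))"
proof -
  have "inj_on (insert x) (Pow A)"
    using assms(2) by (intro inj_onI) (metis Diff_insert_absorb PowD subsetD)
  moreover have "Pow A \<inter> insert x ` Pow A = {}" using assms(2) by auto
  ultimately show ?thesis
    using assms(1) by (simp add: Pow_insert sum.union_disjoint sum.reindex sum.distrib)
qed

lemma fib_pairs_Suc:
  "fib_pairs (Suc m) d =
     2 * fib_pairs m d + fib_pairs m (d - int (fib (m+2))) + fib_pairs m (d + int (fib (m+2)))"
proof -
  let ?I = "{2..<m+2}" and ?F = "fib (m+2)"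
  have I: "{2..<Suc m + 2} = insert (m+2) ?I" by auto
  have ins: "sum fib (insert (m+2) S) = ?F + sum fib S" if "S \<in> Pow ?I" for S
  proof -
    have "finite S" using that finite_subset by auto
    moreover have "m + 2 \<notin> S" using that by auto
    ultimately show ?thesis by simp
  qed
  have split: "(\<Sum>S\<in>Pow (insert (m+2) ?I). f S) = (\<Sum>S\<in>Pow ?I. f S + f (insert (m+2) S))"
    for f :: "nat set \<Rightarrow> nat"
    by (rule sum_Pow_insert) auto
  let ?b = "\<lambda>S T d. of_bool (int (sum fib S) = int (sum fib T) + d) :: nat"
  have "fib_pairs (Suc m) d = (\<Sum>S\<in>Pow ?I. \<Sum>T\<in>Pow ?I.
      ?b S T d + ?b S (insert (m+2) T) d + (?b (insert (m+2) S) T d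
      + ?b (insert (m+2) S) (insert (m+2) T) d))"
    unfolding fib_pairs_def I
    by (simp only: split sum.distrib)
  also have "\<dots> = (\<Sum>S\<in>Pow ?I. \<Sum>T\<in>Pow ?I.
      ?b S T d + ?b S T (d + ?F) + (?b S T (d - ?F) + ?b S T d))"
  proof (intro sum.cong refl)
    fix S T assume "S \<in> Pow ?I" "T \<in> Pow ?I"
    then show "?b S T d + ?b S (insert (m+2) T) d + (?b (insert (m+2) S) T d
        + ?b (insert (m+2) S) (insert (m+2) T) d) =
      ?b S T d + ?b S T (d + ?F) + (?b S T (d - ?F) + ?b S T d)"
      by (simp only: ins) (auto simp: of_bool_def)
  qed
  also have "\<dots> = 2 * fib_pairs m d + fib_pairs m (d - int ?F) + fib_pairs m (d + int ?F)"
    by (simp only: fib_pairs_def sum.distrib)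
  finally show ?thesis .
qed

lemma fib_pairs_uminus: "fib_pairs m (- d) = fib_pairs m d"
  unfolding fib_pairs_def
  by (subst sum.swap) (intro sum.cong refl, auto simp: of_bool_def)

lemma sum_fib_initial: "sum fib {2..<m+2} + 2 = fib (m+3)"
proof (induction m)
  case (Suc m)
  have "{2..<Suc m + 2} = insert (m+2) {2..<m+2}" by auto
  then have "sum fib {2..<Suc m + 2} = fib (m+2) + sum fib {2..<m+2}" by simp
  with Suc show ?case by (simp add: numeral_3_eq_3)
qed (simp add: numeral_3_eq_3)

lemma sum_fib_subset_less:
  assumes "S \<in> Pow {2..<m+2}"
  shows "sum fib S + 2 \<le> fib (m+3)"
proof -
  have "sum fib S \<le> sum fib {2..<m+2}" using assms by (intro sum_mono2) auto
  with sum_fib_initial[of m] show ?thesis by linarith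
qed

lemma fib_pairs_eq_0:
  assumes "d \<ge> int (fib (m+3))"
  shows "fib_pairs m d = 0"
proof -
  have "int (sum fib S) \<noteq> int (sum fib T) + d" if "S \<in> Pow {2..<m+2}" for S T
    using sum_fib_subset_less[OF that] assms by linarith
  then show ?thesis by (simp add: fib_pairs_def)
qed

section \<open>The linear recurrence and its growth\<close>

lemma fib_pairs_rec_zero: "fib_pairs (Suc m) 0 = 2 * fib_pairs m 0 + 2 * fib_pairs m (fib (m+2))"
  using fib_pairs_uminus[of m "int (fib (m+2))"] by (simp add: fib_pairs_Suc)

text \<open>
  At \<open>fib (m + 3)\<close> and at \<open>2 fib (m + 2) \<ge> fib (m + 3)\<close> there are no pairs, because the first \<open>m\<close>
  numbers sum to less.  This is what closes the system.
\<close>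

lemma fib_pairs_rec_outer: "fib_pairs (Suc m) (fib (m+3)) = fib_pairs m (fib (m+1))"
proof -
  have "fib (m+3) = fib (m+2) + fib (m+1)" by (simp add: numeral_3_eq_3)
  then have "int (fib (m+3)) - int (fib (m+2)) = int (fib (m+1))" by simp
  then show ?thesis by (simp only: fib_pairs_Suc) (simp add: fib_pairs_eq_0)
qed

lemma fib_pairs_rec_inner:
  "fib_pairs (Suc m) (fib (m+2)) = fib_pairs m 0 + 2 * fib_pairs m (fib (m+2))"
proof -
  have "fib (m+1) \<le> fib (m+2)" by (rule fib_mono) simp
  then have "fib (m+3) \<le> fib (m+2) + fib (m+2)" by (simp add: numeral_3_eq_3)
  then have "fib_pairs m (int (fib (m+2)) + int (fib (m+2))) = 0"
    by (intro fib_pairs_eq_0) linarith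
  then show ?thesis by (simp only: fib_pairs_Suc) simp
qed

lemma fib_pairs_at_0: "fib_pairs 0 d = of_bool (d = 0)"
  by (auto simp: fib_pairs_def)

text \<open>
  The coefficients \<open>(1, \<lambda> (\<lambda> - 2), \<lambda> - 2)\<close> form a left eigenvector of the matrix of the
  recurrence, so the combination is multiplied by \<open>\<lambda>\<close> in each step.
\<close>

lemma fib_pairs_eigenvector:
  fixes l :: real
  assumes "poly lambda_poly l = 0"
  shows "real (fib_pairs m 0) + l * (l - 2) * real (fib_pairs m (fib (m+2)))
      + (l - 2) * real (fib_pairs m (fib (m+1))) = l ^ m"
proof (induction m)
  case 0
  then show ?case by (simp add: fib_pairs_at_0)
next
  case (Suc m)
  define A B C where "A = real (fib_pairs m 0)" and "B = real (fib_pairs m (fib (m+2)))"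
    and "C = real (fib_pairs m (fib (m+1)))"
  have root: "l * (l * (l - 2)) = 2 + 2 * (l - 2)"
    using assms by (simp add: poly_lambda_poly power3_eq_cube power2_eq_square algebra_simps)
  have A': "real (fib_pairs (Suc m) 0) = 2 * A + 2 * B"
    unfolding A_def B_def fib_pairs_rec_zero by simp
  have B': "real (fib_pairs (Suc m) (fib (Suc m+2))) = C"
    using fib_pairs_rec_outer[of m] by (simp add: C_def numeral_3_eq_3)
  have C': "real (fib_pairs (Suc m) (fib (Suc m+1))) = A + 2 * B"
    using fib_pairs_rec_inner[of m] by (simp add: A_def B_def)
  have "2 * A + 2 * B + l * (l - 2) * C + (l - 2) * (A + 2 * B)
      = l * A + (2 + 2 * (l - 2)) * B + l * (l - 2) * C"
    by (simp add: algebra_simps)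
  also have "\<dots> = l * (A + l * (l - 2) * B + (l - 2) * C)"
    by (simp only: root[symmetric]) (simp add: algebra_simps)
  also have "\<dots> = l ^ Suc m"
    using Suc by (simp add: A_def B_def C_def)
  finally show ?case by (simp only: A' B' C')
qed

text \<open>
  An instance of the fact that an autocorrelation is largest at \<open>0\<close>; for these differences it follows
  from the recurrence alone.
\<close>

lemma fib_pairs_le_zero:
  "fib_pairs m (fib (m+2)) \<le> fib_pairs m 0 \<and> fib_pairs m (fib (m+1)) \<le> fib_pairs m 0"
proof (induction m)
  case 0
  then show ?case by (simp add: fib_pairs_at_0)
next
  case (Suc m)
  then show ?case
    using fib_pairs_rec_zero[of m] fib_pairs_rec_outer[of m] fib_pairs_rec_inner[of m]
    by (simp add: numeral_3_eq_3)
qed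

text \<open>
  The eigenvector identity bounds \<open>\<lambda> ^ m\<close> by \<open>A m\<close> times the sum \<open>\<lambda> ^ 2 - \<lambda> - 1\<close> of its
  coefficients, which is less than \<open>3\<close>.
\<close>

lemma fib_pairs_bounds:
  "lambda1 ^ m / 3 \<le> real (fib_pairs m 0)" "real (fib_pairs m 0) \<le> lambda1 ^ m"
proof -
  define A B C where "A = real (fib_pairs m 0)" and "B = real (fib_pairs m (fib (m+2)))"
    and "C = real (fib_pairs m (fib (m+1)))"
  have nonneg: "A \<ge> 0" "B \<ge> 0" "C \<ge> 0" by (simp_all add: A_def B_def C_def)
  have le: "B \<le> A" "C \<le> A" using fib_pairs_le_zero[of m] by (simp_all add: A_def B_def C_def)
  have eq: "A + lambda1 * (lambda1 - 2) * B + (lambda1 - 2) * C = lambda1 ^ m"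
    using fib_pairs_eigenvector[OF lambda1_root] by (simp add: A_def B_def C_def)
  note l = lambda1_bounds
  have coeff: "lambda1 * (lambda1 - 2) \<ge> 0" "lambda1 - 2 \<ge> 0" using l by simp_all
  have "A \<le> lambda1 ^ m"
    unfolding eq[symmetric] using coeff nonneg by (simp add: add_increasing2)
  then show "real (fib_pairs m 0) \<le> lambda1 ^ m" by (simp add: A_def)
  have "lambda1 * (lambda1 - 2) \<le> 2.49 * 0.49" using l by (intro mult_mono) auto
  then have coeff_le: "lambda1 * (lambda1 - 2) \<le> 1.4" "lambda1 - 2 \<le> 0.6" using l by simp_all
  have "lambda1 * (lambda1 - 2) * B \<le> 1.4 * A"
    using coeff_le coeff nonneg le by (intro mult_mono) auto
  moreover have "(lambda1 - 2) * C \<le> 0.6 * A"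
    using coeff_le coeff nonneg le by (intro mult_mono) auto
  ultimately have "lambda1 ^ m \<le> 3 * A" using eq by simp
  then show "lambda1 ^ m / 3 \<le> real (fib_pairs m 0)" by (simp add: A_def)
qed

section \<open>Comparison with the Fibonacci partition function\<close>

definition fib_reps :: "nat \<Rightarrow> nat \<Rightarrow> nat set set" where
  "fib_reps m n = {S \<in> Pow {2..<m+2}. sum fib S = n}"

lemma finite_fib_reps: "finite (fib_reps m n)"
  by (simp add: fib_reps_def)

lemma fib_less_fib_Suc: "2 \<le> k \<Longrightarrow> fib k < fib (Suc k)"
  by (cases k rule: fib.cases) (auto simp: fib_neq_0_nat)

lemma inj_on_fib: "inj_on fib {2..}"
proof (rule strict_mono_on_imp_inj_on, rule strict_mono_onI)
  fix a b :: nat assume "a \<in> {2..}" "a < b"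
  then have "fib a < fib (Suc a)" "fib (Suc a) \<le> fib b"
    by (auto intro: fib_less_fib_Suc fib_mono)
  then show "fib a < fib b" by simp
qed

lemma image_fib_mem_fib_partitions:
  assumes "S \<in> fib_reps m n"
  shows "fib ` S \<in> fib_partitions n"
proof -
  from assms have S: "S \<subseteq> {2..<m+2}" "sum fib S = n" by (simp_all add: fib_reps_def)
  then have "finite S" using finite_subset by blast
  moreover have "inj_on fib S" using S(1) by (intro inj_on_subset[OF inj_on_fib]) auto
  moreover have "fib ` S \<subseteq> {fib k | k. k \<ge> 2}" using S(1) by fastforce
  ultimately show ?thesis using S(2) by (simp add: fib_partitions_def sum.reindex)
qed

lemma inj_on_image_fib: "inj_on ((`) fib) (fib_reps m n)"
  by (rule inj_on_subset[OF inj_on_image_Pow[OF inj_on_fib]]) (auto simp: fib_reps_def)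

lemma card_fib_reps_le_R: "card (fib_reps m n) \<le> R n"
  unfolding R_def
  using image_fib_mem_fib_partitions inj_on_image_fib finite_fib_partitions
  by (intro card_inj_on_le[of "(`) fib"]) auto

lemma R_eq_card_fib_reps:
  assumes "n < fib (m+2)"
  shows "R n = card (fib_reps m n)"
proof -
  have "fib_partitions n \<subseteq> (`) fib ` fib_reps m n"
  proof
    fix X assume X: "X \<in> fib_partitions n"
    then have fin: "finite X" and sub: "X \<subseteq> fib ` {2..}" and sumX: "\<Sum>X = n"
      by (auto simp: fib_partitions_def)
    then obtain S where S: "S \<subseteq> {2..}" "X = fib ` S" by (meson subset_image_iff)
    have inj: "inj_on fib S" using S(1) by (rule inj_on_subset[OF inj_on_fib])
    have "k < m + 2" if "k \<in> S" for k
    proof -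
      have "fib k \<le> n" using member_le_sum[of "fib k" X "\<lambda>x. x"] that S(2) fin sumX by auto
      then have "fib k < fib (m+2)" using assms by simp
      then show ?thesis using fib_mono[of "m+2" k] by (meson not_le)
    qed
    moreover have "sum fib S = n" using S(2) sumX inj by (simp add: sum.reindex)
    ultimately have "S \<in> fib_reps m n" using S(1) by (auto simp: fib_reps_def)
    then show "X \<in> (`) fib ` fib_reps m n" using S(2) by blast
  qed
  then have "R n \<le> card (fib_reps m n)"
    unfolding R_def by (meson finite_fib_reps surj_card_le)
  with card_fib_reps_le_R[of m n] show ?thesis by simp
qed

lemma card_fib_reps_conv_sum: "card (fib_reps m n) = (\<Sum>S\<in>Pow {2..<m+2}. of_bool (sum fib S = n))"
  by (simp add: fib_reps_def Int_def)

text \<open>A pair \<open>(S, T)\<close> with common sum \<open>n\<close> is a pair of representations of \<open>n\<close>.\<close>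

lemma sum_card_fib_reps_squared:
  "(\<Sum>n=0..H. card (fib_reps m n) ^ 2) =
    (\<Sum>S\<in>Pow {2..<m+2}. \<Sum>T\<in>Pow {2..<m+2}. of_bool (sum fib S = sum fib T \<and> sum fib S \<le> H))"
proof -
  let ?P = "Pow {2..<m+2}"
  have "(\<Sum>n=0..H. card (fib_reps m n) ^ 2) =
      (\<Sum>n=0..H. \<Sum>S\<in>?P. \<Sum>T\<in>?P. of_bool (sum fib S = n) * of_bool (sum fib T = n))"
    by (simp only: card_fib_reps_conv_sum power2_eq_square sum_product)
  also have "\<dots> = (\<Sum>S\<in>?P. \<Sum>n=0..H. \<Sum>T\<in>?P. of_bool (sum fib S = n) * of_bool (sum fib T = n))"
    by (rule sum.swap)
  also have "\<dots> = (\<Sum>S\<in>?P. \<Sum>T\<in>?P. \<Sum>n=0..H. of_bool (sum fib S = n) * of_bool (sum fib T = n))"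
    by (intro sum.cong refl sum.swap)
  also have "\<dots> = (\<Sum>S\<in>?P. \<Sum>T\<in>?P. of_bool (sum fib S = sum fib T \<and> sum fib S \<le> H))"
  proof (intro sum.cong refl)
    fix S T :: "nat set"
    have "(\<Sum>n=0..H. of_bool (sum fib S = n) * of_bool (sum fib T = n)) =
        (\<Sum>n=0..H. if n = sum fib S then of_bool (sum fib S = sum fib T) else (0::nat))"
      by (intro sum.cong refl) auto
    also have "\<dots> = of_bool (sum fib S = sum fib T \<and> sum fib S \<le> H)"
      by (subst sum.delta) auto
    finally show "(\<Sum>n=0..H. of_bool (sum fib S = n) * of_bool (sum fib T = n)) =
        (of_bool (sum fib S = sum fib T \<and> sum fib S \<le> H) :: nat)" .
  qed
  finally show ?thesis .
qed

lemma V_le_fib_pairs: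
  assumes "H < fib (m+2)"
  shows "V H \<le> fib_pairs m 0"
proof -
  have "V H = (\<Sum>n=0..H. card (fib_reps m n) ^ 2)"
    unfolding V_def using assms by (intro sum.cong refl) (simp add: R_eq_card_fib_reps)
  also have "\<dots> \<le> fib_pairs m 0"
    unfolding sum_card_fib_reps_squared fib_pairs_def by (intro sum_mono) (auto simp del: of_nat_sum)
  finally show ?thesis .
qed

lemma fib_pairs_le_V:
  assumes "fib (m+3) \<le> H + 2"
  shows "fib_pairs m 0 \<le> V H"
proof -
  have "sum fib S \<le> H" if "S \<in> Pow {2..<m+2}" for S
    using sum_fib_subset_less[OF that] assms by linarith
  then have "fib_pairs m 0 = (\<Sum>n=0..H. card (fib_reps m n) ^ 2)"
    unfolding sum_card_fib_reps_squared fib_pairs_def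
    by (intro sum.cong refl) (auto simp del: of_nat_sum)
  also have "\<dots> \<le> V H"
    unfolding V_def by (intro sum_mono power_mono card_fib_reps_le_R) simp
  finally show ?thesis .
qed

section \<open>Fibonacci numbers and powers of the golden ratio\<close>

lemma phi_squared: "phi ^ 2 = phi + 1"
proof -
  have "(1 + sqrt 5) ^ 2 = 6 + 2 * sqrt 5" by (simp add: power2_sum)
  then show ?thesis by (simp add: phi_def power_divide field_simps)
qed

lemma phi_gt_1: "phi > 1"
  by (simp add: phi_def real_less_rsqrt)

lemma phi_power_bounds: "phi ^ n \<le> real (fib (n+2)) \<and> real (fib (n+2)) \<le> phi ^ (n+1)"
proof (induction n rule: fib.induct)
  case 1
  show ?case using phi_gt_1 by simp
next
  case 2
  have "sqrt 5 \<le> 3" by (rule real_le_lsqrt) simp_all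
  then have "phi \<le> 2" by (simp add: phi_def)
  moreover have "2 \<le> phi + 1" using phi_gt_1 by simp
  ultimately show ?case using phi_squared by (simp add: power2_eq_square numeral_3_eq_3)
next
  case (3 n)
  have step: "phi ^ Suc (Suc k) = phi ^ Suc k + phi ^ k" for k
  proof -
    have "phi ^ Suc (Suc k) = phi ^ 2 * phi ^ k" by (simp add: power2_eq_square)
    also have "\<dots> = phi ^ Suc k + phi ^ k" unfolding phi_squared by (simp add: algebra_simps)
    finally show ?thesis .
  qed
  have "real (fib (Suc (Suc n) + 2)) = real (fib (Suc n + 2)) + real (fib (n + 2))" by simp
  moreover have "phi ^ (Suc (Suc n) + 1) = phi ^ (Suc n + 1) + phi ^ (n + 1)"
    using step[of "Suc n"] by (simp only: Suc_eq_plus1)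
  ultimately show ?case using 3 step[of n] by linarith
qed

lemma ex_fib_interval:
  assumes "H \<ge> 1"
  obtains j where "fib (j+2) \<le> H" "H < fib (j+3)"
proof -
  have "k < fib (k+2)" for k :: nat
  proof (induction k)
    case (Suc k)
    then show ?case using fib_less_fib_Suc[of "k+2"] by (simp add: numeral_3_eq_3)
  qed simp
  then have ex: "\<exists>k. H < fib (k+2)" by blast
  define k where "k = (LEAST k. H < fib (k+2))"
  have k: "H < fib (k+2)" unfolding k_def by (rule LeastI_ex[OF ex])
  have "k \<noteq> 0" using k assms by (intro notI) simp
  then obtain j where j: "k = Suc j" by (cases k) auto
  have "\<not> H < fib (j+2)" using not_less_Least[of j "\<lambda>k. H < fib (k+2)"] j by (simp add: k_def)
  then show ?thesis using that[of j] k j by (simp add: numeral_3_eq_3)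
qed

section \<open>The order of magnitude\<close>

theorem theorem1p1:
  shows "\<exists>c C :: real. 0 < c \<and> c \<le> C \<and>
    (\<forall>H :: nat. H \<ge> 1 \<longrightarrow>
       c * real H powr (ln lambda1 / ln phi) \<le> real (V H) \<and>
       real (V H) \<le> C * real H powr (ln lambda1 / ln phi))"
proof -
  define a where "a = ln lambda1 / ln phi"
  have l: "lambda1 > 1" using lambda1_bounds by simp
  have a: "a \<ge> 0" using l phi_gt_1 by (simp add: a_def)
  have "phi powr a = exp (a * ln phi)" using phi_gt_1 by (simp add: powr_def)
  also have "\<dots> = lambda1" using phi_gt_1 l by (simp add: a_def)
  finally have phi_a: "phi powr a = lambda1" .
  have phi_power_a: "(phi ^ n) powr a = lambda1 ^ n" for n
  proof -
    have "(phi ^ n) powr a = (phi powr a) powr real n"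
      using phi_gt_1 by (simp add: powr_powr mult.commute flip: powr_realpow)
    then show ?thesis using l by (simp add: phi_a powr_realpow)
  qed
  have bounds: "1 / (3 * lambda1 ^ 3) * real H powr a \<le> real (V H) \<and>
      real (V H) \<le> lambda1 * real H powr a" if H: "H \<ge> 1" for H
  proof -
    obtain j where j: "fib (j+2) \<le> H" "H < fib (j+3)" using ex_fib_interval[OF H] .
    have "phi ^ j \<le> real H" using phi_power_bounds[of j] j(1) by linarith
    then have "(phi ^ j) powr a \<le> real H powr a" using a phi_gt_1 by (intro powr_mono2) auto
    then have lower: "lambda1 ^ j \<le> real H powr a" by (simp only: phi_power_a)
    have "real H \<le> phi ^ (j+2)"
      using phi_power_bounds[of "j+1"] j(2) by (simp add: numeral_3_eq_3)
    then have "real H powr a \<le> (phi ^ (j+2)) powr a" using a by (intro powr_mono2) auto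
    then have upper: "real H powr a \<le> lambda1 ^ (j+2)" by (simp only: phi_power_a)
    have "real (V H) \<le> real (fib_pairs (j+1) 0)"
      using V_le_fib_pairs[of H "j+1"] j(2) by (simp add: numeral_3_eq_3)
    also have "\<dots> \<le> lambda1 ^ (j+1)" by (rule fib_pairs_bounds)
    also have "\<dots> \<le> lambda1 * real H powr a" using lower l by simp
    finally have 1: "real (V H) \<le> lambda1 * real H powr a" .
    (* For j = 0 the truncated j - 1 is 0, and fib 3 - 2 = 0 is still at most H. *)
    have "fib (j - 1 + 3) \<le> H + 2"
      using j(1) H by (cases j) (simp_all add: numeral_3_eq_3)
    then have "real (fib_pairs (j-1) 0) \<le> real (V H)" by (simp add: fib_pairs_le_V)
    then have "lambda1 ^ (j-1) / 3 \<le> real (V H)" using fib_pairs_bounds(1)[of "j-1"] by simp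
    then have "lambda1 ^ (j-1) \<le> 3 * real (V H)" by simp
    then have "lambda1 ^ 3 * lambda1 ^ (j-1) \<le> lambda1 ^ 3 * (3 * real (V H))"
      using l by (intro mult_left_mono) auto
    moreover have "real H powr a \<le> lambda1 ^ 3 * lambda1 ^ (j-1)"
    proof -
      have "lambda1 ^ (j+2) \<le> lambda1 ^ (3 + (j-1))" using l by (intro power_increasing) auto
      with upper show ?thesis by (simp only: power_add)
    qed
    ultimately have "real H powr a \<le> lambda1 ^ 3 * (3 * real (V H))"
      by linarith
    then have "1 / (3 * lambda1 ^ 3) * real H powr a \<le> real (V H)"
      using l by (simp add: field_simps)
    with 1 show ?thesis by simp
  qed
  have "lambda1 ^ 3 \<ge> 1" using l by simp
  then have "1 / (3 * lambda1 ^ 3) \<le> 1" by (subst divide_le_eq_1_pos) linarith+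
  then have "1 / (3 * lambda1 ^ 3) \<le> lambda1" using l by linarith
  moreover have "1 / (3 * lambda1 ^ 3) > 0" using l by simp
  ultimately show ?thesis using bounds unfolding a_def by blast
qed

end
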